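(* For every fixed real $x>0$ and every fixed integer $i\ge 0$, $$\lim_{m\to\infty} r_{i,m}(x)=\left(\!\binom{\lceil x\rceil}{i}\!\right),$$ where $m$ ranges over the integers $m\ge \max(i,1)$.
   Context: For integers $n$ and $k$ (with $n$ possibly zero or negative), let $\binom{n}{k}=0$ if $k<0$, $\binom{n}{0}=1$, and $\binom{n}{k}=\frac{1}{k!}\prod_{l=0}^{k-1}(n-l)$ if $k>0$; and let $\left(\!\binom{n}{k}\!\right)=\binom{n+k-1}{k}$. For an integer $m\ge 1$ and any integer $a$, let $\Lambda_m(a)$ be the $(m+1)\times(m+1)$ matrix whose $(p,q)$ entry is $\left(\!\binom{a}{m+2-p-q}\!\right)$, $1\le p,q\le m+1$. Every real $x$ has a continued fraction $x=[c_1,c_2,\dots]=c_1+\cfrac{1}{c_2+\cdots}$ with $c_1=\lfloor x\rfloor$ (possibly zero or negative), and, if $x$ is not an integer, $[c_2,c_3,\dots]$ the usual continued fraction (with positive integer entries) of $\frac{1}{x-\lfloor x\rfloor}>1$. For rational $x=[c_1,\dots,c_n]$, let $X=\Lambda_m(c_1)\cdots\Lambda_m(c_n)$; the numbers $r_{i,m}(x)$, $0\le i\le m$, are defined by $$(r_{m,m}(x),r_{m-1,m}(x),\dots,r_{1,m}(x),r_{0,m}(x))^\top=\frac{1}{X_{m+1,1}}\,(\text{first column of }X),$$ so $r_{0,m}(x)=1$. For irrational $x$ with convergents $x_n=[c_1,\dots,c_n]$, define $r_{i,m}(x)=\lim_{n\to\infty}r_{i,m}(x_n)$; this limit is known to exist.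 *)

theory Defs
  imports Complex_Main "Jordan_Normal_Form.Matrix"
begin

definition int_binom :: "int \<Rightarrow> int \<Rightarrow> real" where
  "int_binom n k = (if k < 0 then 0 else of_int n gchoose nat k)"

definition multichoose :: "int \<Rightarrow> int \<Rightarrow> real" where
  "multichoose n k = int_binom (n + k - 1) k"

(* Matrix indices start at 0 here, so m + 2 - p - q for p, q = 1, ..., m + 1 becomes m - p - q. *)
definition Lambda_mat :: "nat \<Rightarrow> int \<Rightarrow> real mat" where
  "Lambda_mat m a =
     mat (m + 1) (m + 1) (\<lambda>(p, q). multichoose a (int m - int p - int q))"

definition Lambda_prod :: "nat \<Rightarrow> int list \<Rightarrow> real mat" where
  "Lambda_prod m cs = foldr (\<lambda>c A. Lambda_mat m c * A) cs (1\<^sub>m (m + 1))"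

(* The complete quotients of x. They are meaningful only up to and including the first one
   that is an integer; from there on the values are junk caused by division by zero. *)
primrec cf_rest :: "real \<Rightarrow> nat \<Rightarrow> real" where
  "cf_rest x 0 = x"
| "cf_rest x (Suc n) = 1 / (cf_rest x n - of_int \<lfloor>cf_rest x n\<rfloor>)"

(* The list of the first n partial quotients c_1, ..., c_n. *)
definition cf_prefix :: "real \<Rightarrow> nat \<Rightarrow> int list" where
  "cf_prefix x n = map (\<lambda>j. \<lfloor>cf_rest x j\<rfloor>) [0..<n]"

(* The complete expansion of a rational x; it stops at the first integral complete quotient. *)
definition cf_terms :: "real \<Rightarrow> int list" where
  "cf_terms x = cf_prefix x (Suc (LEAST n. cf_rest x n \<in> \<int>))"

(* Only nonempty lists denote a continued fraction; the value of the empty list is arbitrary. *)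
fun cf_value :: "int list \<Rightarrow> real" where
  "cf_value [] = 0"
| "cf_value [c] = of_int c"
| "cf_value (c # d # cs) = of_int c + 1 / cf_value (d # cs)"

definition convergent_cf :: "real \<Rightarrow> nat \<Rightarrow> real" where
  "convergent_cf x n = cf_value (cf_prefix x n)"

(* The first column of the product, read from top to bottom and divided by its last entry,
   is (r_m, ..., r_1, r_0), so r_i sits in row m - i. Meaningful for i \<le> m only. *)
definition r_rat :: "nat \<Rightarrow> nat \<Rightarrow> real \<Rightarrow> real" where
  "r_rat i m x =
     Lambda_prod m (cf_terms x) $$ (m - i, 0) / Lambda_prod m (cf_terms x) $$ (m, 0)"

definition r_real :: "nat \<Rightarrow> nat \<Rightarrow> real \<Rightarrow> real" where
  "r_real i m x = (if x \<in> \<rat> then r_rat i m x else lim (\<lambda>n. r_rat i m (convergent_cf x n)))"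

(* On rationals the expansion does reach an integral complete quotient, so the minimum taken
   in cf_terms exists. *)
lemma cf_rest_quotient:
  assumes "b > 0"
  shows "\<exists>n. cf_rest (of_int a / of_int b) n \<in> \<int>"
proof -
  have shift: "cf_rest x (Suc n) = cf_rest (cf_rest x 1) n" for x n
    by (induction n) auto
  show ?thesis
    using assms
  proof (induction "nat b" arbitrary: a b rule: less_induct)
    case less
    have fl: "\<lfloor>of_int a / (of_int b :: real)\<rfloor> = a div b"
      by (rule floor_divide_of_int_eq)
    have ab: "(of_int a :: real) = of_int b * of_int (a div b) + of_int (a mod b)"
      by (metis of_int_add of_int_mult mult_div_mod_eq)
    show ?case
    proof (cases "a mod b = 0")
      case True
      with ab less.prems have "(of_int a / of_int b :: real) = of_int (a div b)"
        by (simp add: field_simps)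
      then have "cf_rest (of_int a / of_int b) 0 \<in> \<int>"
        by simp
      then show ?thesis ..
    next
      case False
      with less.prems have pos: "a mod b > 0" "a mod b < b"
        using pos_mod_sign[of b a] pos_mod_bound[of b a] by linarith+
      have "of_int a / of_int b - of_int (a div b) = (of_int (a mod b) / of_int b :: real)"
        using ab less.prems by (simp add: field_simps)
      then have "cf_rest (of_int a / of_int b) 1 = of_int b / of_int (a mod b)"
        by (simp add: fl)
      moreover obtain n where "cf_rest (of_int b / of_int (a mod b)) n \<in> \<int>"
        using less.hyps[of "a mod b" b] pos by auto
      ultimately have "cf_rest (of_int a / of_int b) (Suc n) \<in> \<int>"
        by (simp only: shift)
      then show ?thesis ..
    qed
  qed
qed

lemma cf_rest_Rats:
  assumes "x \<in> \<rat>"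
  shows "\<exists>n. cf_rest x n \<in> \<int>"
  using assms cf_rest_quotient by (metis Rats_cases')

end

theory Submission
  imports Defs
begin

text \<open>
  Write \<open>M\<^sub>c(k)\<close> for \<open>multichoose c k\<close>, the coefficient of \<open>z\<^sup>k\<close> in \<open>(1 - z)\<close> to the power \<open>-c\<close>.
  Read from bottom to top, the product of \<open>Lambda_mat m c\<close> and a column \<open>s\<close> is the convolution of
  \<open>M\<^sub>c\<close> with \<open>s\<close>, cut off at degree \<open>m\<close>. So if \<open>x = [a, c, ...]\<close> is not an integer and \<open>W\<close> is the
  column belonging to the tail \<open>[c, ...]\<close>, which exceeds 1, then \<open>r\<^sub>i(x)\<close> is the \<open>i\<close>-th coefficient of
  the convolution of \<open>M\<^sub>a\<close> with \<open>W q / W 0\<close>. The convolution of \<open>M\<^sub>a\<close> with the constant sequence 1 is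
  \<open>M\<^sub>a\<^sub>+\<^sub>1\<close>, and \<open>a + 1\<close> is the ceiling of \<open>x\<close>. All that is needed is that the top entries of \<open>W\<close>
  become equal in the limit: for fixed \<open>q\<close>, \<open>W q / W 0\<close> tends to 1 as \<open>m\<close> grows.

  This comes from monotonicity. Convolving with \<open>M\<^sub>c\<close> is the \<open>c\<close>-fold iteration of taking partial
  sums, so that columns belonging to positive partial quotients are nonnegative and antitone from top
  to bottom. The differences of neighbouring entries of \<open>W\<close> are the entries of the convolution with
  \<open>M\<^sub>c\<^sub>-\<^sub>1\<close>, and for an antitone nonnegative sequence one more summation gains at least a factor
  \<open>(c + j) / c\<close> at place \<open>j\<close> (\<open>mc_conv_growth\<close>). Close to the top of \<open>W\<close> the place \<open>j\<close> is close to
  \<open>m\<close>, so the relative differences there are \<open>O(c / m)\<close> (\<open>first_column_almost_constant\<close>). The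
  resulting error bound \<open>r_cf_estimate\<close> involves only the first two partial quotients; it is therefore
  the same for all convergents of an irrational \<open>x\<close> from the second on, and passes to their limit.

  For irrational \<open>x\<close> this limit must be shown to exist. The entries of a product
  \<open>Lambda_mat m a * Lambda_mat m b\<close> with \<open>a, b \<ge> 1\<close> agree with those of a matrix of rank one up to a
  factor \<open>m + 1\<close> independent of \<open>a\<close> and \<open>b\<close> (\<open>two_factor_bounds\<close>). Multiplying by such a matrix
  contracts the spread of the quotients of two rows by a fixed factor (\<open>contraction\<close>), as in
  Birkhoff's theorem on positive operators, so the quotients form a Cauchy sequence.
\<close>

section \<open>Multiset coefficients\<close>

lemma multichoose_neg: "k < 0 \<Longrightarrow> multichoose a k = 0"
  by (simp add: multichoose_def int_binom_def)

lemma multichoose_0_right [simp]: "multichoose a 0 = 1"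
  by (simp add: multichoose_def int_binom_def)

lemma multichoose_Pascal:
  "multichoose (a + 1) k = multichoose (a + 1) (k - 1) + multichoose a k"
proof -
  consider "k < 0" | "k = 0" | "k > 0" by linarith
  then show ?thesis
  proof cases
    case 3
    then obtain n where k: "k = int (Suc n)"
      by (metis gr0_implies_Suc pos_int_cases)
    have "nat k = Suc n" "nat (k - 1) = n"
      using k by auto
    moreover have "(of_int (a + 1 + k - 1) :: real) = of_int (a + k - 1) + 1"
      "a + 1 + (k - 1) - 1 = a + k - 1"
      by simp_all
    ultimately show ?thesis
      using 3 by (simp only: multichoose_def int_binom_def gbinomial_Suc_Suc) simp
  qed (simp_all add: multichoose_neg)
qed

lemma multichoose_0_left: "multichoose 0 k = (if k = 0 then 1 else 0)"
proof -
  consider "k < 0" | "k = 0" | "k > 0" by linarith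
  then show ?thesis
  proof cases
    case 3
    then obtain n where k: "k = int (Suc n)"
      by (metis gr0_implies_Suc pos_int_cases)
    have "(real n gchoose Suc n) = 0"
      by (simp flip: binomial_gbinomial)
    moreover have "nat k = Suc n" "(of_int (0 + k - 1) :: real) = real n"
      using k by auto
    ultimately show ?thesis
      using 3 by (simp only: multichoose_def int_binom_def) simp
  qed (simp_all add: multichoose_neg)
qed

lemma multichoose_nonneg:
  assumes "a \<ge> 0"
  shows "multichoose a k \<ge> 0"
proof -
  have pos: "multichoose (int n) (int l) \<ge> 0" for n l
  proof (induction n arbitrary: l)
    case 0
    show ?case by (simp add: multichoose_0_left)
  next
    case (Suc n)
    show ?case
    proof (induction l)
      case (Suc l)
      then show ?case
        using multichoose_Pascal[of "int n" "int (Suc l)"] \<open>multichoose (int n) (int (Suc l)) \<ge> 0\<close>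
        by (simp add: add.commute)
    qed simp
  qed
  show ?thesis
    using assms pos[of "nat a" "nat k"] by (cases "k < 0") (auto simp: multichoose_neg)
qed

lemma multichoose_mono:
  assumes "a \<ge> 1" "k \<le> l"
  shows "multichoose a k \<le> multichoose a l"
  using assms(2)
proof (induction l rule: int_ge_induct)
  case (step l)
  then show ?case
    using multichoose_Pascal[of "a - 1" "l + 1"] multichoose_nonneg[of "a - 1" "l + 1"] assms(1)
    by simp
qed simp

lemma multichoose_ge_1:
  assumes "a \<ge> 1" "k \<ge> 0"
  shows "multichoose a k \<ge> 1"
  using multichoose_mono[OF assms] by simp

section \<open>Convolution with multiset coefficients\<close>

definition mc_conv :: "int \<Rightarrow> (nat \<Rightarrow> real) \<Rightarrow> nat \<Rightarrow> real" where
  "mc_conv c s j = (\<Sum>q\<le>j. multichoose c (int j - int q) * s q)"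

lemma mc_conv_0_index [simp]: "mc_conv c s 0 = s 0"
  by (simp add: mc_conv_def)

lemma mc_conv_0 [simp]: "mc_conv 0 s j = s j"
proof -
  have "mc_conv 0 s j = (\<Sum>q\<le>j. if q = j then s q else 0)"
    unfolding mc_conv_def by (rule sum.cong) (auto simp: multichoose_0_left)
  then show ?thesis by simp
qed

text \<open>By Pascal's rule, raising \<open>c\<close> by one takes partial sums of the convolution.\<close>

lemma mc_conv_Suc:
  "mc_conv (c + 1) s (Suc j) = mc_conv (c + 1) s j + mc_conv c s (Suc j)"
proof -
  have "mc_conv (c + 1) s (Suc j) =
      (\<Sum>q\<le>Suc j. multichoose (c + 1) (int j - int q) * s q) + mc_conv c s (Suc j)"
    unfolding mc_conv_def sum.distrib[symmetric]
  proof (rule sum.cong)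
    fix q
    show "multichoose (c + 1) (int (Suc j) - int q) * s q =
      multichoose (c + 1) (int j - int q) * s q + multichoose c (int (Suc j) - int q) * s q"
      using multichoose_Pascal[of c "int (Suc j) - int q"] by (simp add: algebra_simps)
  qed simp
  then show ?thesis
    by (simp add: mc_conv_def multichoose_neg)
qed

lemma mc_conv_const_1: "mc_conv c (\<lambda>_. 1) j = multichoose (c + 1) (int j)"
proof (induction j)
  case (Suc j)
  have "mc_conv c (\<lambda>_. 1) (Suc j) = (\<Sum>q\<le>Suc j. multichoose c (int q))"
    unfolding mc_conv_def
    by (rule sum.reindex_bij_witness[of _ "\<lambda>q. Suc j - q" "\<lambda>q. Suc j - q"]) (auto simp: of_nat_diff)
  moreover have "mc_conv c (\<lambda>_. 1) j = (\<Sum>q\<le>j. multichoose c (int q))"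
    unfolding mc_conv_def
    by (rule sum.reindex_bij_witness[of _ "\<lambda>q. j - q" "\<lambda>q. j - q"]) (auto simp: of_nat_diff)
  ultimately show ?case
    using Suc multichoose_Pascal[of c "int (Suc j)"] by simp
qed simp

lemma mc_conv_nonneg:
  assumes "c \<ge> 0" "\<And>q. q \<le> j \<Longrightarrow> s q \<ge> 0"
  shows "mc_conv c s j \<ge> 0"
  unfolding mc_conv_def using assms by (intro sum_nonneg mult_nonneg_nonneg multichoose_nonneg) auto

lemma mc_conv_mono:
  assumes "c \<ge> 0" "\<And>q. q \<le> j \<Longrightarrow> s q \<le> t q"
  shows "mc_conv c s j \<le> mc_conv c t j"
  unfolding mc_conv_def using assms by (intro sum_mono mult_left_mono multichoose_nonneg) auto

lemma mc_conv_scale: "mc_conv c (\<lambda>q. s q * b) j = mc_conv c s j * b"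
  by (simp add: mc_conv_def sum_distrib_right mult.assoc)

text \<open>If \<open>s\<close> is constant, both sides agree, because \<open>(c + 1) M\<^sub>c\<^sub>+\<^sub>2(j) = (j + c + 1) M\<^sub>c\<^sub>+\<^sub>1(j)\<close>. For an antitone
\<open>s\<close> the inequality says that a sequence which has its mass at the beginning gains at least as much
from a further summation. The case \<open>c = 0\<close> is the only one that uses monotonicity.\<close>

lemma mc_conv_growth:
  assumes "\<And>q. q < m \<Longrightarrow> s (Suc q) \<le> s q" "s 0 \<ge> 0" "j \<le> m"
  shows "real (j + c + 1) * mc_conv (int c) s j \<le> real (c + 1) * mc_conv (int c + 1) s j"
  using assms(3)
proof (induction c arbitrary: j)
  case 0
  then show ?case
  proof (induction j)
    case (Suc j)
    have "real (j + 1) * s (Suc j) \<le> real (j + 1) * s j"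
      using Suc.prems assms(1)[of j] by (intro mult_left_mono) auto
    then show ?case
      using Suc mc_conv_Suc[of 0 s j] by (simp add: algebra_simps)
  qed simp
next
  case (Suc c)
  note outer = Suc.IH
  show ?case
    using Suc.prems
  proof (induction j)
    case (Suc j)
    \<comment> \<open>Write \<open>R\<^sub>c(j)\<close> for the convolution. The bound at \<open>j\<close> controls \<open>R\<^sub>c\<^sub>+\<^sub>1(j)\<close>, which
      differs from \<open>R\<^sub>c\<^sub>+\<^sub>1(j+1)\<close> by \<open>R\<^sub>c(j+1)\<close>; the bound for \<open>c\<close> controls this.\<close>
    have "real (j + Suc c + 1) * mc_conv (int c + 1) s j
        \<le> real (Suc c + 1) * mc_conv (int c + 1 + 1) s j"
      using Suc by (simp add: add.commute add.left_commute)
    moreover have "real (j + c + 2) * mc_conv (int c) s (Suc j)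
        \<le> real (c + 1) * mc_conv (int c + 1) s (Suc j)"
      using outer[OF Suc.prems] by simp
    ultimately show ?case
      using mc_conv_Suc[of "int c + 1" s j] mc_conv_Suc[of "int c" s j]
      by (simp add: algebra_simps)
  qed simp
qed

section \<open>First columns of products\<close>

lemma Lambda_mat_carrier [simp]: "Lambda_mat m c \<in> carrier_mat (m + 1) (m + 1)"
  by (simp add: Lambda_mat_def)

lemma Lambda_prod_carrier [simp]: "Lambda_prod m cs \<in> carrier_mat (m + 1) (m + 1)"
proof (induction cs)
  case (Cons c cs)
  show ?case
    unfolding Lambda_prod_def foldr_Cons comp_def
    using mult_carrier_mat[OF Lambda_mat_carrier Cons, of c] by (simp add: Lambda_prod_def)
qed (simp add: Lambda_prod_def)

lemma Lambda_prod_Nil [simp]: "Lambda_prod m [] = 1\<^sub>m (m + 1)"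
  by (simp add: Lambda_prod_def)

lemma Lambda_prod_Cons: "Lambda_prod m (c # cs) = Lambda_mat m c * Lambda_prod m cs"
  by (simp add: Lambda_prod_def)

lemma Lambda_prod_snoc: "Lambda_prod m (cs @ [c]) = Lambda_prod m cs * Lambda_mat m c"
proof (induction cs)
  case Nil
  show ?case
    using right_mult_one_mat[OF Lambda_mat_carrier, of m c]
      left_mult_one_mat[OF Lambda_mat_carrier, of m c] by (simp add: Lambda_prod_Cons)
next
  case (Cons b cs)
  then show ?case
    using assoc_mult_mat[OF Lambda_mat_carrier Lambda_prod_carrier Lambda_mat_carrier, of m b cs c]
    by (simp add: Lambda_prod_Cons)
qed

lemma mult_mat_entry:
  assumes "A \<in> carrier_mat n n" "B \<in> carrier_mat n n" "p < n" "q < n"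
  shows "(A * B) $$ (p, q) = (\<Sum>k<n. A $$ (p, k) * B $$ (k, q))"
  using assms by (auto simp: scalar_prod_def atLeast0LessThan)

lemma Lambda_mat_entry:
  "p \<le> m \<Longrightarrow> q \<le> m \<Longrightarrow> Lambda_mat m c $$ (p, q) = multichoose c (int m - int p - int q)"
  by (simp add: Lambda_mat_def)

lemma first_column_Cons:
  assumes "i \<le> m"
  shows "Lambda_prod m (c # cs) $$ (m - i, 0) = mc_conv c (\<lambda>q. Lambda_prod m cs $$ (q, 0)) i"
proof -
  have "Lambda_prod m (c # cs) $$ (m - i, 0) =
      (\<Sum>q<m+1. Lambda_mat m c $$ (m - i, q) * Lambda_prod m cs $$ (q, 0))"
    unfolding Lambda_prod_Cons
    by (rule mult_mat_entry[OF Lambda_mat_carrier Lambda_prod_carrier]) auto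
  also have "\<dots> = (\<Sum>q<m+1. multichoose c (int i - int q) * Lambda_prod m cs $$ (q, 0))"
    using assms by (intro sum.cong) (auto simp: Lambda_mat_entry of_nat_diff)
  also have "\<dots> = (\<Sum>q\<le>i. multichoose c (int i - int q) * Lambda_prod m cs $$ (q, 0))"
    using assms by (intro sum.mono_neutral_right) (auto simp: multichoose_neg)
  finally show ?thesis
    by (simp add: mc_conv_def)
qed

lemma first_column_Cons_row:
  assumes "q \<le> m"
  shows "Lambda_prod m (c # cs) $$ (q, 0) = mc_conv c (\<lambda>q. Lambda_prod m cs $$ (q, 0)) (m - q)"
  using first_column_Cons[of "m - q" m c cs] assms by simp

text \<open>The drop from one entry to the next lower one is an entry of the convolution with the coefficients
of \<open>c - 1 \<ge> 0\<close>, hence nonnegative. The empty product fits in: its column is \<open>(1, 0, ..., 0)\<close>.\<close>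

lemma first_column_antitone:
  assumes "\<And>c. c \<in> set cs \<Longrightarrow> c \<ge> 1"
  shows first_column_nonneg: "q \<le> m \<Longrightarrow> Lambda_prod m cs $$ (q, 0) \<ge> 0"
    and first_column_Suc_le: "q < m \<Longrightarrow> Lambda_prod m cs $$ (Suc q, 0) \<le> Lambda_prod m cs $$ (q, 0)"
    and first_column_pos: "Lambda_prod m cs $$ (0, 0) > 0"
proof -
  have "(\<forall>q\<le>m. Lambda_prod m cs $$ (q, 0) \<ge> 0) \<and>
    (\<forall>q<m. Lambda_prod m cs $$ (Suc q, 0) \<le> Lambda_prod m cs $$ (q, 0)) \<and>
    Lambda_prod m cs $$ (0, 0) > 0"
    using assms
  proof (induction cs)
    case (Cons c cs)
    let ?s = "\<lambda>q. Lambda_prod m cs $$ (q, 0)"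
    have c: "c \<ge> 1"
      using Cons.prems by simp
    have s: "?s q \<ge> 0" if "q \<le> m" for q
      using Cons that by auto
    have s0: "?s 0 > 0"
      using Cons by auto
    have step: "mc_conv c ?s k \<le> mc_conv c ?s (Suc k)" if "Suc k \<le> m" for k
      using mc_conv_Suc[of "c - 1" ?s k] mc_conv_nonneg[of "c - 1" "Suc k" ?s] c s that by simp
    have "mc_conv c ?s (m - Suc q) \<le> mc_conv c ?s (m - q)" if "q < m" for q
      using step[of "m - Suc q"] that by (simp add: Suc_diff_Suc)
    moreover have "mc_conv c ?s k > 0" if "k \<le> m" for k
      using that
    proof (induction k)
      case (Suc k)
      then show ?case using step[of k] by simp
    qed (use s0 in simp)
    ultimately show ?case
      by (auto simp: first_column_Cons_row less_imp_le)
  qed simp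
  then show "q \<le> m \<Longrightarrow> Lambda_prod m cs $$ (q, 0) \<ge> 0"
    "q < m \<Longrightarrow> Lambda_prod m cs $$ (Suc q, 0) \<le> Lambda_prod m cs $$ (q, 0)"
    "Lambda_prod m cs $$ (0, 0) > 0"
    by auto
qed

text \<open>By \<open>mc_conv_growth\<close>, the drop from the entry in row \<open>p\<close> to the next one is at most \<open>c / (m - p + c)\<close>
times that entry. Summing the first \<open>q\<close> drops gives the lower bound.\<close>

lemma first_column_almost_constant:
  assumes cs: "\<And>d. d \<in> set (c # cs) \<Longrightarrow> d \<ge> 1" and "q \<le> m"
  defines "W \<equiv> \<lambda>q. Lambda_prod m (c # cs) $$ (q, 0)"
  shows "W q \<le> W 0"
    and "W 0 * (1 - real q * of_int c / (real m - real q + of_int c)) \<le> W q"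
proof -
  let ?s = "\<lambda>q. Lambda_prod m cs $$ (q, 0)"
  have c: "c \<ge> 1"
    using cs by simp
  have le: "W p \<le> W 0" if "p \<le> m" for p
    using that
  proof (induction p)
    case (Suc p)
    then show ?case
      using first_column_Suc_le[of "c # cs" p m] cs unfolding W_def by auto
  qed simp
  then show "W q \<le> W 0"
    using assms by simp
  have W0: "W 0 > 0"
    using first_column_pos[of "c # cs"] cs unfolding W_def by blast
  have drop: "W p - W (Suc p) \<le> of_int c / (real m - real q + of_int c) * W 0"
    if p: "p < q" for p
  proof -
    have pm: "p < m" and k: "m - p = Suc (m - Suc p)"
      using p assms by auto
    have "W p - W (Suc p) = mc_conv (c - 1) ?s (m - p)"
      using mc_conv_Suc[of "c - 1" ?s "m - Suc p"] pm k
      by (simp add: W_def first_column_Cons_row)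
    moreover have "(real m - real p + of_int c) * mc_conv (c - 1) ?s (m - p)
        \<le> of_int c * W p"
    proof -
      have "real (m - p + nat (c - 1) + 1) * mc_conv (int (nat (c - 1))) ?s (m - p)
          \<le> real (nat (c - 1) + 1) * mc_conv (int (nat (c - 1)) + 1) ?s (m - p)"
      proof (rule mc_conv_growth[of m])
        show "?s (Suc r) \<le> ?s r" if "r < m" for r
          using first_column_Suc_le[of cs r m] cs that by simp
        show "?s 0 \<ge> 0"
          using first_column_nonneg[of cs 0 m] cs by simp
      qed simp
      then show ?thesis
        using c pm by (simp add: of_nat_diff algebra_simps W_def first_column_Cons_row)
    qed
    moreover have "(real m - real p + of_int c) > 0"
      using c pm by (simp add: add_pos_pos)
    ultimately have "W p - W (Suc p) \<le> of_int c * W p / (real m - real p + of_int c)"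
      by (simp add: pos_le_divide_eq mult.commute)
    also have "\<dots> \<le> of_int c * W 0 / (real m - real q + of_int c)"
    proof (rule frac_le)
      show "0 < real m - real q + of_int c"
      proof -
        have "real q \<le> real m" "(1 :: real) \<le> of_int c"
          using assms(2) c by simp_all
        then show ?thesis by linarith
      qed
    qed (use le[of p] c p W0 pm in auto)
    finally show ?thesis by simp
  qed
  have "W 0 - W p \<le> real p * (of_int c / (real m - real q + of_int c) * W 0)" if "p \<le> q" for p
    using that
  proof (induction p)
    case (Suc p)
    then have "W 0 - W p \<le> real p * (of_int c / (real m - real q + of_int c) * W 0)"
      by simp
    then have "W 0 - W (Suc p) \<le> real p * (of_int c / (real m - real q + of_int c) * W 0)
        + of_int c / (real m - real q + of_int c) * W 0"
      using drop[of p] Suc.prems by linarith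
    moreover have "real (Suc p) * z = real p * z + z" for z :: real
      by (simp add: algebra_simps)
    ultimately show ?case
      by metis
  qed simp
  from this[of q] show "W 0 * (1 - real q * of_int c / (real m - real q + of_int c)) \<le> W q"
    by (simp add: algebra_simps)
qed

section \<open>The uniform estimate\<close>

definition r_cf :: "nat \<Rightarrow> nat \<Rightarrow> int list \<Rightarrow> real" where
  "r_cf i m cs = Lambda_prod m cs $$ (m - i, 0) / Lambda_prod m cs $$ (m, 0)"

text \<open>This is the value at an integer, where the sequence in \<open>m\<close> is constant as soon as \<open>m \<ge> i\<close>.\<close>

lemma r_cf_singleton:
  assumes "i \<le> m"
  shows "r_cf i m [c] = multichoose c (int i)"
proof -
  have "Lambda_prod m [c] $$ (m - k, 0) = multichoose c (int k)" if "k \<le> m" for k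
  proof -
    have "Lambda_prod m [c] $$ (m - k, 0) = mc_conv c (\<lambda>q. if q = 0 then 1 else 0) k"
      unfolding first_column_Cons[OF that] mc_conv_def using that by (intro sum.cong) auto
    also have "\<dots> = multichoose c (int k)"
      by (simp add: mc_conv_def if_distrib cong: if_cong)
    finally show ?thesis .
  qed
  from this[OF assms] this[of 0] show ?thesis
    by (simp add: r_cf_def)
qed

text \<open>Replacing the column of the tail by the constant column \<open>W 0\<close> turns the convolution into
\<open>multichoose (a + 1) (int i) * W 0\<close>. The later partial quotients \<open>cs\<close> do not occur in the bound, which
is what allows a passage to the limit along convergents.\<close>

lemma r_cf_estimate:
  assumes "a \<ge> 0" and cs: "\<And>d. d \<in> set (c # cs) \<Longrightarrow> d \<ge> 1" and im: "i \<le> m"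
  shows "\<bar>r_cf i m (a # c # cs) - multichoose (a + 1) (int i)\<bar>
    \<le> multichoose (a + 1) (int i) * (real i * of_int c / (real m - real i + of_int c))"
proof -
  define W where "W = (\<lambda>q. Lambda_prod m (c # cs) $$ (q, 0))"
  define e where "e = real i * of_int c / (real m - real i + of_int c)"
  have c: "c \<ge> 1"
    using cs by simp
  have W0: "W 0 > 0"
    using first_column_pos[of "c # cs"] cs unfolding W_def by blast
  have lower: "(1 - e) * W 0 \<le> W q" if "q \<le> i" for q
  proof -
    have "real q * of_int c / (real m - real q + of_int c) \<le> e"
      unfolding e_def using that c im by (intro frac_le mult_right_mono) auto
    then have "(1 - e) * W 0 \<le> W 0 * (1 - real q * of_int c / (real m - real q + of_int c))"
      using W0 by simp
    also have "\<dots> \<le> W q"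
      unfolding W_def using cs that im by (intro first_column_almost_constant) auto
    finally show ?thesis .
  qed
  have upper: "W q \<le> 1 * W 0" if "q \<le> i" for q
    using first_column_almost_constant(1)[of c cs q m] cs that im by (auto simp: W_def)
  have r: "r_cf i m (a # c # cs) = mc_conv a W i / W 0"
    using first_column_Cons[OF im, of a "c # cs"] first_column_Cons[of 0 m a "c # cs"]
    by (simp add: r_cf_def W_def)
  have "mc_conv a W i \<le> multichoose (a + 1) (int i) * W 0"
    using mc_conv_mono[of a i W "\<lambda>q. 1 * W 0"] upper assms(1)
    by (simp only: mc_conv_scale mc_conv_const_1)
  moreover have "(1 - e) * multichoose (a + 1) (int i) * W 0 \<le> mc_conv a W i"
    using mc_conv_mono[of a i "\<lambda>q. 1 * ((1 - e) * W 0)" W] lower assms(1)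
    unfolding mc_conv_scale mc_conv_const_1 by (simp add: algebra_simps)
  ultimately have "r_cf i m (a # c # cs) \<le> multichoose (a + 1) (int i)"
    "(1 - e) * multichoose (a + 1) (int i) \<le> r_cf i m (a # c # cs)"
    using W0 by (simp_all add: r field_simps)
  then show ?thesis
    unfolding e_def[symmetric] by (simp add: algebra_simps)
qed

section \<open>Projective contraction\<close>

text \<open>The set of bounds \<open>l\<close>, \<open>h\<close> with \<open>l g \<le> f \<le> h g\<close> describes the spread of the quotients \<open>f / g\<close>. The
nonnegative row \<open>d = f - l g\<close> is mapped to a row that is, up to the factor \<open>K\<close>, a multiple of \<open>\<beta>\<close>,
and so is \<open>g\<close>. Hence the image of \<open>d\<close> dominates a multiple of the image of \<open>g\<close>, by which \<open>l\<close> may be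
raised; \<open>h\<close> is lowered in the same way. The two gains add up to \<open>(h - l) / K\<close> because together the
rows \<open>f - l g\<close> and \<open>h g - f\<close> make \<open>(h - l) g\<close>.\<close>

lemma contraction:
  fixes f g :: "nat \<Rightarrow> real" and N :: "nat \<Rightarrow> nat \<Rightarrow> real"
  assumes l: "\<And>p. p < n \<Longrightarrow> l * g p \<le> f p" and h: "\<And>p. p < n \<Longrightarrow> f p \<le> h * g p"
    and g: "\<And>p. p < n \<Longrightarrow> g p > 0" and n: "n > 0" and K: "K \<ge> 1"
    and \<alpha>: "\<And>p. p < n \<Longrightarrow> \<alpha> p > 0"
    and lower: "\<And>p q. p < n \<Longrightarrow> q < n \<Longrightarrow> \<alpha> p * \<beta> q \<le> N p q"
    and upper: "\<And>p q. p < n \<Longrightarrow> q < n \<Longrightarrow> N p q \<le> K * (\<alpha> p * \<beta> q)"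
  shows "\<exists>l' h'. h' - l' = (1 - 1 / K) * (h - l) \<and>
    (\<forall>q<n. l' * (\<Sum>p<n. g p * N p q) \<le> (\<Sum>p<n. f p * N p q) \<and>
           (\<Sum>p<n. f p * N p q) \<le> h' * (\<Sum>p<n. g p * N p q))"
proof -
  define G where "G = (\<Sum>p<n. g p * \<alpha> p)"
  define F where "F = (\<Sum>p<n. f p * \<alpha> p)"
  have G: "G > 0"
    unfolding G_def using g \<alpha> n by (intro sum_pos) auto
  have gain: "(\<Sum>p<n. d p * \<alpha> p) / (K * G) * (\<Sum>p<n. g p * N p q) \<le> (\<Sum>p<n. d p * N p q)"
    if q: "q < n" and d: "\<And>p. p < n \<Longrightarrow> d p \<ge> 0" for d q
  proof -
    have "(\<Sum>p<n. g p * N p q) \<le> (\<Sum>p<n. g p * (K * (\<alpha> p * \<beta> q)))"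
      using upper q g by (intro sum_mono mult_left_mono) (auto intro: less_imp_le)
    also have "\<dots> = K * G * \<beta> q"
      by (simp add: G_def sum_distrib_left sum_distrib_right mult_ac)
    finally have "(\<Sum>p<n. d p * \<alpha> p) / (K * G) * (\<Sum>p<n. g p * N p q)
        \<le> (\<Sum>p<n. d p * \<alpha> p) / (K * G) * (K * G * \<beta> q)"
      using d \<alpha> K G by (intro mult_left_mono divide_nonneg_nonneg sum_nonneg mult_nonneg_nonneg)
        (auto intro: less_imp_le)
    also have "\<dots> = (\<Sum>p<n. d p * (\<alpha> p * \<beta> q))"
    proof -
      have "x / (K * G) * (K * G * \<beta> q) = x * \<beta> q" for x
        using K G by simp
      then show ?thesis
        by (simp only: sum_distrib_right mult.assoc)
    qed
    also have "\<dots> \<le> (\<Sum>p<n. d p * N p q)"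
      using lower q d by (intro sum_mono mult_left_mono) auto
    finally show ?thesis .
  qed
  have sl: "(\<Sum>p<n. (f p - l * g p) * x p) = (\<Sum>p<n. f p * x p) - l * (\<Sum>p<n. g p * x p)"
    and sh: "(\<Sum>p<n. (h * g p - f p) * x p) = h * (\<Sum>p<n. g p * x p) - (\<Sum>p<n. f p * x p)" for x
    by (simp_all add: sum_subtractf sum_distrib_left algebra_simps)
  define \<delta> where "\<delta> = (F - l * G) / (K * G)"
  define \<epsilon> where "\<epsilon> = (h * G - F) / (K * G)"
  have "(l + \<delta>) * (\<Sum>p<n. g p * N p q) \<le> (\<Sum>p<n. f p * N p q)" if "q < n" for q
    using gain[of q "\<lambda>p. f p - l * g p"] l that
    unfolding sl \<delta>_def F_def[symmetric] G_def[symmetric] by (simp add: algebra_simps)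
  moreover have "(\<Sum>p<n. f p * N p q) \<le> (h - \<epsilon>) * (\<Sum>p<n. g p * N p q)" if "q < n" for q
    using gain[of q "\<lambda>p. h * g p - f p"] h that
    unfolding sh \<epsilon>_def F_def[symmetric] G_def[symmetric] by (simp add: algebra_simps)
  moreover have "(h - \<epsilon>) - (l + \<delta>) = (1 - 1 / K) * (h - l)"
    using G K unfolding \<delta>_def \<epsilon>_def by (simp add: field_simps)
  ultimately show ?thesis by blast
qed

text \<open>A single nonnegative factor preserves bounds on the quotients and a pair of factors contracts them,
so the quotients are confined to nested intervals whose lengths tend to 0. Pairs of factors are
needed because one matrix \<open>Lambda_mat m c\<close> has zero entries.\<close>

lemma ratio_convergent:
  fixes f g :: "nat \<Rightarrow> nat \<Rightarrow> real" and M :: "nat \<Rightarrow> nat \<Rightarrow> nat \<Rightarrow> real"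
  assumes f: "\<And>k q. q < n \<Longrightarrow> f (Suc k) q = (\<Sum>p<n. f k p * M k p q)"
    and g: "\<And>k q. q < n \<Longrightarrow> g (Suc k) q = (\<Sum>p<n. g k p * M k p q)"
    and M: "\<And>k p q. p < n \<Longrightarrow> q < n \<Longrightarrow> M k p q \<ge> 0"
    and pos: "\<And>k q. q < n \<Longrightarrow> g k q > 0" and K: "K \<ge> 1"
    and \<alpha>: "\<And>k p. p < n \<Longrightarrow> \<alpha> k p > 0"
    and lower: "\<And>k p q. p < n \<Longrightarrow> q < n \<Longrightarrow>
      \<alpha> k p * \<beta> k q \<le> (\<Sum>t<n. M k p t * M (Suc k) t q)"
    and upper: "\<And>k p q. p < n \<Longrightarrow> q < n \<Longrightarrow>
      (\<Sum>t<n. M k p t * M (Suc k) t q) \<le> K * (\<alpha> k p * \<beta> k q)"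
    and r: "r < n"
  shows "convergent (\<lambda>k. f k r / g k r)"
proof -
  define P where "P = (\<lambda>l h k. \<forall>q<n. l * g k q \<le> f k q \<and> f k q \<le> h * g k q)"
  have mono: "P l h k" if "P l h k0" "k0 \<le> k" for l h k0 k
    using that(2,1)
  proof (induction k rule: dec_induct)
    case (step k)
    have IH: "l * g k p \<le> f k p" "f k p \<le> h * g k p" if "p < n" for p
      using step that unfolding P_def by auto
    have "(\<Sum>p<n. l * g k p * M k p q) \<le> (\<Sum>p<n. f k p * M k p q)"
      "(\<Sum>p<n. f k p * M k p q) \<le> (\<Sum>p<n. h * g k p * M k p q)" if "q < n" for q
      using IH M that by (auto intro!: sum_mono mult_right_mono)
    then show ?case
      unfolding P_def by (simp add: f g sum_distrib_left mult.assoc)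
  qed simp
  have two: "F (Suc (Suc k)) q = (\<Sum>p<n. F k p * (\<Sum>t<n. M k p t * M (Suc k) t q))"
    if "\<And>k q. q < n \<Longrightarrow> F (Suc k) q = (\<Sum>p<n. F k p * M k p q)" and q: "q < n"
    for F :: "nat \<Rightarrow> nat \<Rightarrow> real" and k q
  proof -
    have "F (Suc (Suc k)) q = (\<Sum>t<n. \<Sum>p<n. F k p * (M k p t * M (Suc k) t q))"
      using that by (simp add: sum_distrib_right mult.assoc)
    then show ?thesis
      by (subst (asm) sum.swap) (simp add: sum_distrib_left)
  qed
  have contract: "\<exists>l' h'. h' - l' = (1 - 1 / K) * (h - l) \<and> P l' h' (Suc (Suc k))"
    if "P l h k" for l h k
  proof -
    have n: "n > 0"
      using r by simp
    have "\<exists>l' h'. h' - l' = (1 - 1 / K) * (h - l) \<and>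
      (\<forall>q<n. l' * (\<Sum>p<n. g k p * (\<Sum>t<n. M k p t * M (Suc k) t q))
             \<le> (\<Sum>p<n. f k p * (\<Sum>t<n. M k p t * M (Suc k) t q)) \<and>
             (\<Sum>p<n. f k p * (\<Sum>t<n. M k p t * M (Suc k) t q))
             \<le> h' * (\<Sum>p<n. g k p * (\<Sum>t<n. M k p t * M (Suc k) t q)))"
      using that unfolding P_def
      by (intro contraction[where \<alpha> = "\<alpha> k" and \<beta> = "\<beta> k"] pos K \<alpha> lower upper n) auto
    then show ?thesis
      unfolding P_def by (simp add: two[OF f] two[OF g] del: mult_cancel_left mult_cancel_right)
  qed
  obtain C where C: "P (- C) C 0"
  proof
    let ?C = "\<Sum>q<n. \<bar>f 0 q / g 0 q\<bar>"
    have "\<bar>f 0 q / g 0 q\<bar> \<le> ?C" if "q < n" for q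
      using that by (intro member_le_sum) auto
    then have "\<bar>f 0 q\<bar> \<le> ?C * g 0 q" if "q < n" for q
      using that pos[of q 0] by (metis abs_divide abs_of_pos pos_divide_le_eq)
    then show "P (- ?C) ?C 0"
      unfolding P_def by (auto simp: abs_le_iff minus_le_iff)
  qed
  have iter: "\<exists>l h. h - l = (1 - 1 / K) ^ j * (2 * C) \<and> P l h (2 * j)" for j
  proof (induction j)
    case 0
    show ?case using C by (intro exI[of _ "- C"] exI[of _ C]) simp
  next
    case (Suc j)
    then show ?case
      by (metis contract mult.assoc mult_Suc_right power_Suc add_2_eq_Suc)
  qed
  have "Cauchy (\<lambda>k. f k r / g k r)"
  proof (rule metric_CauchyI)
    fix e :: real
    assume e: "e > 0"
    have "(\<lambda>j. (1 - 1 / K) ^ j * (2 * C)) \<longlonglongrightarrow> 0 * (2 * C)"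
      using K by (intro tendsto_mult LIMSEQ_power_zero tendsto_const) auto
    then have "\<forall>\<^sub>F j in sequentially. (1 - 1 / K) ^ j * (2 * C) < e"
      using e order_tendstoD(2) by force
    then obtain j where j: "(1 - 1 / K) ^ j * (2 * C) < e"
      by (auto simp: eventually_sequentially)
    obtain l h where "h - l = (1 - 1 / K) ^ j * (2 * C)" and Plh: "P l h (2 * j)"
      using iter[of j] by blast
    with j have lh: "h - l < e"
      by simp
    have "l \<le> f k r / g k r \<and> f k r / g k r \<le> h" if "k \<ge> 2 * j" for k
      using mono[OF Plh that] pos[OF r, of k] r
      unfolding P_def by (auto simp: field_simps)
    then have "dist (f k r / g k r) (f k' r / g k' r) < e" if "k \<ge> 2 * j" "k' \<ge> 2 * j" for k k'
      using that lh unfolding dist_real_def by (smt (verit))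
    then show "\<exists>N. \<forall>k\<ge>N. \<forall>k'\<ge>N. dist (f k r / g k r) (f k' r / g k' r) < e"
      by blast
  qed
  then show ?thesis
    by (simp add: Cauchy_convergent_iff)
qed

text \<open>Each summand is at most the one for \<open>t = 0\<close>, since the coefficients for a positive upper argument
increase. That summand is the rank one matrix, and it is also a lower bound of the sum.\<close>

lemma two_factor_bounds:
  assumes "a \<ge> 1" "b \<ge> 1" "p \<le> m" "q \<le> m"
  defines "N \<equiv> (\<Sum>t<m+1. Lambda_mat m a $$ (p, t) * Lambda_mat m b $$ (t, q))"
  shows "multichoose a (int m - int p) * multichoose b (int m - int q) \<le> N"
    and "N \<le> real (m + 1) * (multichoose a (int m - int p) * multichoose b (int m - int q))"
proof -
  let ?h = "\<lambda>t. multichoose a (int m - int p - int t) * multichoose b (int m - int t - int q)"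
  have N: "N = (\<Sum>t<m+1. ?h t)"
    unfolding N_def using assms by (intro sum.cong) (auto simp: Lambda_mat_entry)
  have "?h 0 \<le> N"
    unfolding N using assms by (intro member_le_sum) (auto intro!: mult_nonneg_nonneg multichoose_nonneg)
  then show "multichoose a (int m - int p) * multichoose b (int m - int q) \<le> N"
    by simp
  have "?h t \<le> ?h 0" for t
    using assms by (intro mult_mono multichoose_mono multichoose_nonneg) auto
  then have "N \<le> real (card {..<m+1}) * ?h 0"
    unfolding N by (intro sum_bounded_above) auto
  then show "N \<le> real (m + 1) * (multichoose a (int m - int p) * multichoose b (int m - int q))"
    by simp
qed

lemma r_cf_convergent:
  assumes b: "\<And>j. j \<ge> 1 \<Longrightarrow> b j \<ge> 1" and "i \<le> m"
  shows "convergent (\<lambda>k. r_cf i m (map b [0..<k]))"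
proof -
  \<comment> \<open>Row \<open>m\<close> of the first factor is \<open>(1, 0, ..., 0)\<close>, so it takes two factors to make the row of
    denominators positive.\<close>
  define X where "X k = Lambda_prod m (map b [0..<k+2])" for k
  have X: "X k $$ (p, q) = (\<Sum>t<m+1. Lambda_prod m (map b [0..<k+1]) $$ (p, t) * Lambda_mat m (b (k+1)) $$ (t, q))"
    if "p < m + 1" "q < m + 1" for k p q
    using that mult_mat_entry[OF Lambda_prod_carrier Lambda_mat_carrier that, of "map b [0..<k+1]" "b (k+1)"]
    by (simp add: X_def Lambda_prod_snoc[symmetric])
  have X_Suc: "X (Suc k) $$ (p, q) = (\<Sum>t<m+1. X k $$ (p, t) * Lambda_mat m (b (k+2)) $$ (t, q))"
    if "p < m + 1" "q < m + 1" for k p q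
    using X[OF that, of "Suc k"] by (simp add: X_def del: sum.lessThan_Suc upt_Suc)
  have nonneg: "Lambda_mat m (b (k + 2)) $$ (p, q) \<ge> 0" if "p < m + 1" "q < m + 1" for k p q
    using that b[of "k + 2"] by (simp add: Lambda_mat_entry multichoose_nonneg)
  have pos: "X k $$ (m, q) > 0" if "q < m + 1" for k q
    using that
  proof (induction k arbitrary: q)
    case 0
    have "X 0 $$ (m, q) = (\<Sum>t<m+1. Lambda_mat m (b 0) $$ (m, t) * Lambda_mat m (b 1) $$ (t, q))"
      using X[of m q 0] 0 right_mult_one_mat[OF Lambda_mat_carrier, of m "b 0"]
      by (simp add: Lambda_prod_Cons del: sum.lessThan_Suc)
    also have "\<dots> = (\<Sum>t<m+1. if t = 0 then multichoose (b 1) (int m - int q) else 0)"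
      using 0 by (intro sum.cong) (auto simp: Lambda_mat_entry multichoose_neg)
    also have "\<dots> \<ge> 1"
      using 0 multichoose_ge_1[of "b 1" "int m - int q"] b[of 1] by (simp del: sum.lessThan_Suc)
    finally show ?case by simp
  next
    case (Suc k)
    have "X k $$ (m, 0) * Lambda_mat m (b (k+2)) $$ (0, q)
        \<le> (\<Sum>t<m+1. X k $$ (m, t) * Lambda_mat m (b (k+2)) $$ (t, q))"
      using Suc.prems
      by (intro member_le_sum mult_nonneg_nonneg less_imp_le[OF Suc.IH] nonneg) auto
    then have "X k $$ (m, 0) * Lambda_mat m (b (k+2)) $$ (0, q) \<le> X (Suc k) $$ (m, q)"
      using X_Suc Suc.prems by simp
    moreover have "Lambda_mat m (b (k+2)) $$ (0, q) > 0"
      using Suc.prems multichoose_ge_1[of "b (k+2)" "int m - int q"] b[of "k+2"]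
      by (simp add: Lambda_mat_entry)
    ultimately show ?case
      using Suc.IH[of 0] by (smt (verit) mult_pos_pos zero_less_Suc Suc_eq_plus1)
  qed
  have "convergent (\<lambda>k. X k $$ (m - i, 0) / X k $$ (m, 0))"
  proof (rule ratio_convergent[where n = "m + 1" and K = "real (m + 1)"
        and f = "\<lambda>k q. X k $$ (m - i, q)" and g = "\<lambda>k q. X k $$ (m, q)"
        and M = "\<lambda>k p q. Lambda_mat m (b (k + 2)) $$ (p, q)"
        and \<alpha> = "\<lambda>k p. multichoose (b (k + 2)) (int m - int p)"
        and \<beta> = "\<lambda>k q. multichoose (b (Suc k + 2)) (int m - int q)"])
    show "multichoose (b (k + 2)) (int m - int p) > 0" if "p < m + 1" for k p
      using that multichoose_ge_1[of "b (k + 2)" "int m - int p"] b[of "k + 2"] by simp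
    show "multichoose (b (k + 2)) (int m - int p) * multichoose (b (Suc k + 2)) (int m - int q)
        \<le> (\<Sum>t<m + 1. Lambda_mat m (b (k + 2)) $$ (p, t) * Lambda_mat m (b (Suc k + 2)) $$ (t, q))"
      if "p < m + 1" "q < m + 1" for k p q
      using that b by (intro two_factor_bounds) auto
    show "(\<Sum>t<m + 1. Lambda_mat m (b (k + 2)) $$ (p, t) * Lambda_mat m (b (Suc k + 2)) $$ (t, q))
        \<le> real (m + 1) *
           (multichoose (b (k + 2)) (int m - int p) * multichoose (b (Suc k + 2)) (int m - int q))"
      if "p < m + 1" "q < m + 1" for k p q
      using that b by (intro two_factor_bounds) auto
    show "X (Suc k) $$ (m - i, q)
        = (\<Sum>p<m + 1. X k $$ (m - i, p) * Lambda_mat m (b (k + 2)) $$ (p, q))"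
      if "q < m + 1" for k q
      using that by (intro X_Suc) auto
    show "X (Suc k) $$ (m, q) = (\<Sum>p<m + 1. X k $$ (m, p) * Lambda_mat m (b (k + 2)) $$ (p, q))"
      if "q < m + 1" for k q
      using that by (intro X_Suc) auto
  qed (use nonneg pos in auto)
  then show ?thesis
    unfolding X_def r_cf_def[symmetric]
    using convergent_ignore_initial_segment[of "\<lambda>k. r_cf i m (map b [0..<k])" 2] by simp
qed

section \<open>Continued fraction expansions\<close>

lemma cf_rest_shift: "cf_rest x (Suc n) = cf_rest (1 / (x - of_int \<lfloor>x\<rfloor>)) n"
  by (induction n) auto

lemma cf_prefix_Suc: "cf_prefix x (Suc n) = \<lfloor>x\<rfloor> # cf_prefix (1 / (x - of_int \<lfloor>x\<rfloor>)) n"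
proof -
  have "cf_prefix x (Suc n) = \<lfloor>cf_rest x 0\<rfloor> # map (\<lambda>j. \<lfloor>cf_rest x j\<rfloor>) (map Suc [0..<n])"
    unfolding cf_prefix_def by (simp add: upt_conv_Cons map_Suc_upt del: upt_Suc)
  then show ?thesis
    by (simp add: cf_prefix_def cf_rest_shift del: cf_rest.simps(2))
qed

lemma tl_cf_prefix: "tl (cf_prefix x (Suc n)) = map (\<lambda>j. \<lfloor>cf_rest x (Suc j)\<rfloor>) [0..<n]"
  unfolding cf_prefix_Suc by (simp add: cf_prefix_def cf_rest_shift del: cf_rest.simps(2))

lemma inverse_frac_gt_1:
  fixes x :: real
  assumes "x \<notin> \<int>"
  shows "1 / (x - of_int \<lfloor>x\<rfloor>) > 1"
proof -
  have "x - of_int \<lfloor>x\<rfloor> \<noteq> 0"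
    using assms by (metis Ints_of_int eq_iff_diff_eq_0)
  then have "0 < x - of_int \<lfloor>x\<rfloor>" "x - of_int \<lfloor>x\<rfloor> < 1"
    by linarith+
  then show ?thesis by simp
qed

lemma cf_rest_gt_1:
  assumes "cf_rest x j \<notin> \<int>"
  shows "cf_rest x (Suc j) > 1"
  using inverse_frac_gt_1[OF assms] by simp

lemma cf_terms_Ints: "x \<in> \<int> \<Longrightarrow> cf_terms x = [\<lfloor>x\<rfloor>]"
  by (simp add: cf_terms_def Least_eq_0 cf_prefix_def)

lemma cf_terms_Cons:
  assumes "x \<in> \<rat>" "x \<notin> \<int>"
  shows "cf_terms x = \<lfloor>x\<rfloor> # cf_terms (1 / (x - of_int \<lfloor>x\<rfloor>))"
proof -
  obtain n where "cf_rest x n \<in> \<int>"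
    using cf_rest_Rats assms by blast
  then have "(LEAST n. cf_rest x n \<in> \<int>) = Suc (LEAST n. cf_rest x (Suc n) \<in> \<int>)"
    using assms by (intro Least_Suc) auto
  then show ?thesis
    unfolding cf_terms_def cf_rest_shift by (simp add: cf_prefix_Suc)
qed

lemma cf_terms_ge_1:
  assumes "y \<in> \<rat>" "y \<ge> 1" "d \<in> set (cf_terms y)"
  shows "d \<ge> 1"
proof -
  let ?n = "LEAST n. cf_rest y n \<in> \<int>"
  obtain j where j: "d = \<lfloor>cf_rest y j\<rfloor>" "j \<le> ?n"
    using assms(3) unfolding cf_terms_def cf_prefix_def by auto
  have "cf_rest y j \<ge> 1"
  proof (cases j)
    case (Suc k)
    then have "cf_rest y k \<notin> \<int>"
      using j not_less_Least[of k "\<lambda>n. cf_rest y n \<in> \<int>"] by auto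
    then show ?thesis
      using cf_rest_gt_1 Suc by fastforce
  qed (use assms in simp)
  then show ?thesis
    using j by simp
qed

lemma cf_value_ge_1:
  assumes "cs \<noteq> []" "\<And>d. d \<in> set cs \<Longrightarrow> d \<ge> 1"
  shows "cf_value cs \<ge> 1"
  using assms
proof (induction cs rule: cf_value.induct)
  case (3 c d cs)
  then have "cf_value (d # cs) \<ge> 1" "c \<ge> 1"
    by auto
  then show ?case
    by (simp add: add_increasing2)
qed auto

lemma cf_value_Rats: "cf_value cs \<in> \<rat>"
  by (induction cs rule: cf_value.induct) auto

text \<open>The expansions \<open>[..., c, 1]\<close> and \<open>[..., c + 1]\<close> of a rational number give the same column: the
column of \<open>[1]\<close> is constantly 1, and convolving with it raises \<open>c\<close> by one.\<close>

lemma first_column_merge_1: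
  assumes "i \<le> m"
  shows "Lambda_prod m [c, 1] $$ (m - i, 0) = Lambda_prod m [c + 1] $$ (m - i, 0)"
proof -
  have single: "Lambda_prod m [a] $$ (m - k, 0) = multichoose a (int k)" if "k \<le> m" for a k
    using r_cf_singleton[OF that, of a] first_column_Cons[of 0 m a "[]"] by (simp add: r_cf_def)
  have one: "multichoose 1 (int k) = 1" for k
    using mc_conv_const_1[of 0 k] by simp
  have "Lambda_prod m [c, 1] $$ (m - i, 0) = mc_conv c (\<lambda>q. 1) i"
    unfolding first_column_Cons[OF assms] mc_conv_def
  proof (intro sum.cong refl)
    fix q assume "q \<in> {..i}"
    then have "Lambda_prod m [1] $$ (q, 0) = 1"
      using single[of "m - q" 1] one[of "m - q"] assms by simp
    then show "multichoose c (int i - int q) * Lambda_prod m [1] $$ (q, 0)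
      = multichoose c (int i - int q) * 1" by simp
  qed
  then show ?thesis
    using single[OF assms] by (simp add: mc_conv_const_1)
qed

text \<open>A list of partial quotients and the expansion of its value can differ only by a final 1, which
occurs for convergents. By \<open>first_column_merge_1\<close> the first column does not notice.\<close>

lemma first_column_cf_terms:
  assumes "cs \<noteq> []" "\<And>d. d \<in> set (tl cs) \<Longrightarrow> d \<ge> 1" "i \<le> m"
  shows "Lambda_prod m (cf_terms (cf_value cs)) $$ (m - i, 0) = Lambda_prod m cs $$ (m - i, 0)"
  using assms
proof (induction cs arbitrary: i rule: cf_value.induct)
  case (2 c)
  then show ?case by (simp add: cf_terms_Ints)
next
  case (3 c d cs)
  define y where "y = cf_value (d # cs)"
  have y: "y \<ge> 1"
    unfolding y_def using 3 by (intro cf_value_ge_1) auto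
  have x: "cf_value (c # d # cs) = of_int c + 1 / y"
    by (simp add: y_def)
  show ?case
  proof (cases "y = 1")
    case True
    have "d # cs = [1]"
    proof (cases cs)
      case Nil
      then show ?thesis using True by (simp add: y_def)
    next
      case (Cons e es)
      have "cf_value (e # es) \<ge> 1"
        using 3 Cons by (intro cf_value_ge_1) auto
      then have "1 / cf_value (e # es) > 0"
        by simp
      moreover have "(of_int d :: real) \<ge> 1"
        using 3 by simp
      ultimately have "y > 1"
        unfolding y_def Cons cf_value.simps by linarith
      then show ?thesis using True by simp
    qed
    moreover have "cf_terms (cf_value (c # d # cs)) = [c + 1]"
      using cf_terms_Ints[of "of_int (c + 1)"] True unfolding x by simp
    ultimately show ?thesis
      using first_column_merge_1[OF 3(4)] by simp
  next
    case False
    then have y1: "y > 1"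
      using y by simp
    then have inv: "0 < 1 / y" "1 / y < 1"
      by simp_all
    then have fl: "\<lfloor>of_int c + 1 / y\<rfloor> = c"
      by (simp add: floor_eq_iff)
    have "of_int c + 1 / y \<notin> \<int>"
      using inv fl by (metis Ints_cases floor_of_int add_cancel_left_right less_irrefl)
    moreover have "of_int c + 1 / y \<in> \<rat>"
      using cf_value_Rats[of "c # d # cs"] x by simp
    ultimately have terms: "cf_terms (cf_value (c # d # cs)) = c # cf_terms y"
      unfolding x using cf_terms_Cons fl by simp
    have "Lambda_prod m (cf_terms y) $$ (m - k, 0) = Lambda_prod m (d # cs) $$ (m - k, 0)"
      if "k \<le> m" for k
      unfolding y_def using 3 that by simp
    then have "Lambda_prod m (cf_terms y) $$ (q, 0) = Lambda_prod m (d # cs) $$ (q, 0)"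
      if "q \<le> m" for q
      using that by (metis diff_diff_cancel diff_le_self)
    then show ?thesis
      unfolding terms first_column_Cons[OF 3(4)] mc_conv_def
      using 3(4) by (intro sum.cong) auto
  qed
qed simp

lemma r_rat_convergent_cf:
  assumes "\<And>j. cf_rest x j \<notin> \<int>" "n > 0" "i \<le> m"
  shows "r_rat i m (convergent_cf x n) = r_cf i m (cf_prefix x n)"
proof -
  have tl: "d \<ge> 1" if d: "d \<in> set (tl (cf_prefix x n))" for d
  proof -
    obtain k where n: "n = Suc k"
      using assms(2) gr0_implies_Suc by blast
    then obtain j where "d = \<lfloor>cf_rest x (Suc j)\<rfloor>"
      using d by (auto simp: tl_cf_prefix simp del: cf_rest.simps(2))
    then show ?thesis
      using cf_rest_gt_1[OF assms(1)[of j]] by linarith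
  qed
  have "cf_prefix x n \<noteq> []"
    using assms(2) by (simp add: cf_prefix_def)
  from first_column_cf_terms[OF this tl assms(3)] first_column_cf_terms[OF this tl, of 0 m]
  show ?thesis
    by (simp add: r_rat_def r_cf_def convergent_cf_def)
qed

text \<open>For rational \<open>x\<close> this is \<open>r_cf_estimate\<close> for the complete expansion. For irrational \<open>x\<close> it holds for
every convergent with at least two partial quotients, always with the same first two, and therefore
for the limit.\<close>

lemma r_real_estimate:
  assumes x: "x > 0" "x \<notin> \<int>" and im: "i \<le> m"
  defines "c \<equiv> \<lfloor>1 / (x - of_int \<lfloor>x\<rfloor>)\<rfloor>"
  shows "\<bar>r_real i m x - multichoose \<lceil>x\<rceil> (int i)\<bar>
    \<le> multichoose \<lceil>x\<rceil> (int i) * (real i * of_int c / (real m - real i + of_int c))"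
    (is "_ \<le> ?B")
proof -
  define y where "y = 1 / (x - of_int \<lfloor>x\<rfloor>)"
  have y: "y > 1"
    unfolding y_def using x by (intro inverse_frac_gt_1)
  have a: "\<lfloor>x\<rfloor> \<ge> 0"
    using x by simp
  have ceil: "\<lceil>x\<rceil> = \<lfloor>x\<rfloor> + 1"
    using x by (metis Ints_of_int ceiling_altdef)
  have est: "\<bar>r_cf i m (\<lfloor>x\<rfloor> # c # cs) - multichoose \<lceil>x\<rceil> (int i)\<bar> \<le> ?B"
    if "\<And>d. d \<in> set (c # cs) \<Longrightarrow> d \<ge> 1" for cs
    unfolding ceil using r_cf_estimate[OF a that im] by simp
  show ?thesis
  proof (cases "x \<in> \<rat>")
    case True
    have yQ: "y \<in> \<rat>"
      using True by (simp add: y_def)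
    have "\<exists>cs. cf_terms y = c # cs"
      unfolding cf_terms_def cf_prefix_Suc c_def y_def by simp
    then obtain cs where cs: "cf_terms y = c # cs" ..
    have "r_real i m x = r_cf i m (\<lfloor>x\<rfloor> # c # cs)"
      using True x cs by (simp add: r_real_def r_rat_def r_cf_def cf_terms_Cons y_def)
    moreover have "d \<ge> 1" if "d \<in> set (c # cs)" for d
      using cf_terms_ge_1[OF yQ] y cs that by simp
    ultimately show ?thesis
      using est by simp
  next
    case False
    have irr: "cf_rest x j \<notin> \<rat>" for j
    proof (induction j)
      case (Suc j)
      show ?case
      proof
        assume "cf_rest x (Suc j) \<in> \<rat>"
        then have "1 / cf_rest x (Suc j) + of_int \<lfloor>cf_rest x j\<rfloor> \<in> \<rat>"
          by (intro Rats_add Rats_divide) auto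
        then show False
          using Suc by simp
      qed
    qed (use False in simp)
    then have nonint: "cf_rest x j \<notin> \<int>" for j
      using Ints_subset_Rats by blast
    define b where "b = (\<lambda>j. \<lfloor>cf_rest x j\<rfloor>)"
    have b: "b j \<ge> 1" if "j \<ge> 1" for j
      using cf_rest_gt_1[OF nonint[of "j - 1"]] that unfolding b_def
      by (simp del: cf_rest.simps(2))
    have "convergent (\<lambda>n. r_cf i m (map b [0..<n]))"
      using b im by (rule r_cf_convergent)
    then obtain L where L: "(\<lambda>n. r_cf i m (cf_prefix x n)) \<longlonglongrightarrow> L"
      by (auto simp: convergent_def cf_prefix_def b_def)
    have "\<bar>r_cf i m (cf_prefix x n) - multichoose \<lceil>x\<rceil> (int i)\<bar> \<le> ?B" if "n \<ge> 2" for n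
    proof -
      obtain k where n: "n = Suc (Suc k)"
        using \<open>n \<ge> 2\<close> by (metis add_2_eq_Suc le_Suc_ex)
      obtain cs where cs: "cf_prefix y (Suc k) = c # cs"
        unfolding cf_prefix_Suc c_def y_def by simp
      have "d \<ge> 1" if "d \<in> set (c # cs)" for d
      proof -
        have "c # cs = map (\<lambda>j. b (Suc j)) [0..<Suc k]"
          using tl_cf_prefix[of x "Suc k"]
          unfolding cs[symmetric] y_def cf_prefix_Suc[of x] list.sel b_def .
        then have "d \<in> (\<lambda>j. b (Suc j)) ` set [0..<Suc k]"
          using that by (simp only: set_map)
        then obtain j where "d = b (Suc j)" ..
        then show ?thesis
          using b by simp
      qed
      moreover have "cf_prefix x n = \<lfloor>x\<rfloor> # c # cs"
        unfolding n cf_prefix_Suc[of x] cs[symmetric] y_def ..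
      ultimately show ?thesis
        using est by simp
    qed
    then have "\<bar>L - multichoose \<lceil>x\<rceil> (int i)\<bar> \<le> ?B"
      by (intro tendsto_upperbound[OF tendsto_rabs[OF tendsto_diff[OF L tendsto_const]]])
        (auto simp: eventually_sequentially)
    moreover have "(\<lambda>n. r_rat i m (convergent_cf x n)) \<longlonglongrightarrow> L"
      using L by (rule Lim_transform_eventually)
        (auto simp: eventually_sequentially r_rat_convergent_cf[OF nonint _ im] intro!: exI[of _ 1])
    ultimately show ?thesis
      using False by (simp add: r_real_def limI)
  qed
qed

theorem theorem5:
  fixes x :: real and i :: nat
  assumes "x > 0"
  shows "(\<lambda>m. r_real i m x) \<longlonglongrightarrow> multichoose \<lceil>x\<rceil> (int i)"
proof (cases "x \<in> \<int>")
  case True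
  have "r_real i m x = multichoose \<lceil>x\<rceil> (int i)" if "m \<ge> i" for m
  proof -
    have "x \<in> \<rat>" "\<lfloor>x\<rfloor> = \<lceil>x\<rceil>"
      using True Ints_subset_Rats by (auto elim!: Ints_cases)
    then show ?thesis
      using r_cf_singleton[OF that] True by (simp add: r_real_def r_rat_def r_cf_def cf_terms_Ints)
  qed
  then show ?thesis
    by (intro tendsto_eventually) (auto simp: eventually_sequentially)
next
  case False
  define c where "c = \<lfloor>1 / (x - of_int \<lfloor>x\<rfloor>)\<rfloor>"
  let ?B = "\<lambda>m. multichoose \<lceil>x\<rceil> (int i) * (real i * of_int c / (real m - real i + of_int c))"
  have "filterlim (\<lambda>m. (of_int c - real i) + real m) at_top sequentially"
    by (intro filterlim_tendsto_add_at_top[OF tendsto_const] filterlim_real_sequentially)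
  then have "(\<lambda>m. real i * of_int c / (real m - real i + of_int c)) \<longlonglongrightarrow> 0"
    by (intro tendsto_divide_0[OF tendsto_const] filterlim_at_top_imp_at_infinity)
      (simp add: algebra_simps)
  then have B: "?B \<longlonglongrightarrow> 0"
    by (rule tendsto_mult_right_zero)
  have "(\<lambda>m. r_real i m x - multichoose \<lceil>x\<rceil> (int i)) \<longlonglongrightarrow> 0"
    using B
  proof (rule tendsto_0_le[where K = 1])
    show "\<forall>\<^sub>F m in sequentially. norm (r_real i m x - multichoose \<lceil>x\<rceil> (int i)) \<le> norm (?B m) * 1"
    proof (rule eventually_sequentiallyI[of i])
      fix m assume "i \<le> m"
      then have "\<bar>r_real i m x - multichoose \<lceil>x\<rceil> (int i)\<bar> \<le> ?B m"
        unfolding c_def by (rule r_real_estimate[OF assms False])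
      also have "\<dots> \<le> \<bar>?B m\<bar>"
        by (rule abs_ge_self)
      finally show "norm (r_real i m x - multichoose \<lceil>x\<rceil> (int i)) \<le> norm (?B m) * 1"
        unfolding real_norm_def mult_1_right .
    qed
  qed
  then show ?thesis
    by (rule LIM_zero_cancel)
qed

end
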